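(* Let $\mathcal H$ be a real Hilbert space, $C\subseteq\mathcal H$ nonempty, closed and convex, and $F:\mathcal H\to\mathcal H$. Assume that $SOL(C,F)\neq\emptyset$, that $F$ is monotone on $\mathcal H$ ($\langle F(x)-F(y),x-y\rangle\ge 0$ for all $x,y\in\mathcal H$), and that $F$ is Lipschitz continuous on $\mathcal H$ with some constant $L>0$. Assume that the sequences $\{\alpha_k^{(i)}\}_{k=0}^\infty\subset[0,1]$, $i=1,2$, satisfy $$\sum_{k=0}^\infty\alpha_k^{(i)}\|x^k-x^{k-1}\|<+\infty,\qquad i=1,2.$$ Then any sequence $\{x^k\}_{k=0}^\infty$ generated by the inertial PC-algorithm I (iPC I-1) described in the context converges weakly to a point of $SOL(C,F)$, i.e. to a solution of the variational inequality problem.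
   Context: The variational inequality problem is: find $x^*\in C$ with $\langle F(x^* ),x-x^*\rangle\ge 0$ for all $x\in C$; its solution set is $SOL(C,F)$. $P_C$ denotes the metric projection onto $C$. Inertial PC-algorithm I (iPC I-1): fix $\nu\in(0,1)$, $\gamma\in(0,2)$ and starting points $x^{-1},x^0\in\mathcal H$. Given $x^{k-1},x^k$, set $$y^k=P_C(x^k-\beta_kF(x^k))+\alpha_k^{(1)}(x^k-x^{k-1}),\qquad z^k:=y^k-\alpha_k^{(1)}(x^k-x^{k-1}),$$ where $\beta_k>0$ is selected to satisfy $\beta_k\|F(x^k)-F(z^k)\|\le\nu\|x^k-z^k\|$. Define $$d(x^k,z^k)=(x^k-z^k)-\beta_k(F(x^k)-F(z^k)),\qquad \rho_k=\frac{\langle x^k-z^k,d(x^k,z^k)\rangle}{\|d(x^k,z^k)\|^2},$$ $$x^{k+1}=x^k-\gamma\rho_kd(x^k,z^k)+\alpha_k^{(2)}(x^k-x^{k-1}).$$ It is understood that $d(x^k,z^k)\ne0$ for all $k$, so that $\rho_k$ is defined.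
   Formalization: The step sizes β_k are additionally assumed bounded below by a positive constant; without this the claim fails, e.g. for F the identity on C = H = ℝ, both α sequences zero, γ = 1, x^0 ≠ 0 and summable β_k ≤ ν, where x^k tends to a nonzero point. *)

theory Defs
  imports "HOL-Analysis.Analysis"
begin

definition SOL :: "'a::real_inner set \<Rightarrow> ('a \<Rightarrow> 'a) \<Rightarrow> 'a set" where
  "SOL C F = {x \<in> C. \<forall>y\<in>C. inner (F x) (y - x) \<ge> 0}"

definition monotone_operator :: "('a::real_inner \<Rightarrow> 'a) \<Rightarrow> bool" where
  "monotone_operator F \<longleftrightarrow> (\<forall>x y. inner (F x - F y) (x - y) \<ge> 0)"

(* Same defining term as the library's closest_point, whose type is restricted to the class
   heine_borel, i.e. to finite dimension. In a Hilbert space the nearest point of a nonempty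
   closed convex set exists and is unique, so the choice is harmless there. *)
definition metric_projection :: "'a::real_inner set \<Rightarrow> 'a \<Rightarrow> 'a" where
  "metric_projection C a = (SOME x. x \<in> C \<and> (\<forall>y\<in>C. dist a x \<le> dist a y))"

definition converges_weakly :: "(nat \<Rightarrow> 'a::real_normed_vector) \<Rightarrow> 'a \<Rightarrow> bool" where
  "converges_weakly u l \<longleftrightarrow>
     (\<forall>f::'a \<Rightarrow> real. bounded_linear f \<longrightarrow> (\<lambda>k. f (u k)) \<longlonglongrightarrow> f l)"

(* x^(k-1), where the starting point x^(-1) is passed separately as the argument xm. *)
definition previous :: "'a \<Rightarrow> (nat \<Rightarrow> 'a) \<Rightarrow> nat \<Rightarrow> 'a" where
  "previous xm x k = (case k of 0 \<Rightarrow> xm | Suc j \<Rightarrow> x j)"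

definition pc_direction :: "('a::real_inner \<Rightarrow> 'a) \<Rightarrow> real \<Rightarrow> 'a \<Rightarrow> 'a \<Rightarrow> 'a" where
  "pc_direction F b x z = (x - z) - b *\<^sub>R (F x - F z)"

definition pc_rho :: "('a::real_inner \<Rightarrow> 'a) \<Rightarrow> real \<Rightarrow> 'a \<Rightarrow> 'a \<Rightarrow> real" where
  "pc_rho F b x z = inner (x - z) (pc_direction F b x z) / (norm (pc_direction F b x z))\<^sup>2"

(* x, y, z are sequences of iterates generated from the starting points xm and x 0.
   The conjunct pc_direction ... \<noteq> 0 is the requirement that the quotient pc_rho is defined.
   Positivity of each \<beta> k does not prevent \<beta> k \<longlonglongrightarrow> 0. If that happens too fast (F = identity on
   the real line, \<beta> summable), then x need not converge to a solution. A positive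
   lower bound on \<beta> is not part of this definition and has to be assumed by convergence results. *)
definition iPC_I1 ::
  "'a::real_inner set \<Rightarrow> ('a \<Rightarrow> 'a) \<Rightarrow> real \<Rightarrow> real \<Rightarrow> (nat \<Rightarrow> real) \<Rightarrow> (nat \<Rightarrow> real)
     \<Rightarrow> (nat \<Rightarrow> real) \<Rightarrow> 'a \<Rightarrow> (nat \<Rightarrow> 'a) \<Rightarrow> (nat \<Rightarrow> 'a) \<Rightarrow> (nat \<Rightarrow> 'a) \<Rightarrow> bool" where
  "iPC_I1 C F \<nu> \<gamma> \<alpha>1 \<alpha>2 \<beta> xm x y z \<longleftrightarrow>
     (\<forall>k. y k = metric_projection C (x k - \<beta> k *\<^sub>R F (x k)) + \<alpha>1 k *\<^sub>R (x k - previous xm x k) \<and>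
          z k = y k - \<alpha>1 k *\<^sub>R (x k - previous xm x k) \<and>
          0 < \<beta> k \<and>
          \<beta> k * norm (F (x k) - F (z k)) \<le> \<nu> * norm (x k - z k) \<and>
          pc_direction F (\<beta> k) (x k) (z k) \<noteq> 0 \<and>
          x (Suc k) = x k - (\<gamma> * pc_rho F (\<beta> k) (x k) (z k)) *\<^sub>R pc_direction F (\<beta> k) (x k) (z k)
                      + \<alpha>2 k *\<^sub>R (x k - previous xm x k))"

end

theory Submission
  imports Defs
begin

text \<open>
  Write \<open>d k\<close> for the search direction. Every solution \<open>p\<close> lies behind the hyperplane
  through \<open>z k\<close> with normal \<open>d k\<close>: the obtuse-angle property of the projection and the
  monotonicity of \<open>F\<close> give \<open>(z k - p) \<bullet> d k \<ge> 0\<close>. The point \<open>x k - \<gamma> * \<rho> k * d k\<close> is a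
  relaxed projection of \<open>x k\<close> onto this hyperplane, so it is closer to \<open>p\<close> than \<open>x k\<close> is,
  and the gain in squared distance is at least a constant times \<open>norm (x k - z k)\<^sup>2\<close>
  (lemma \<open>contraction_step_decrease\<close>). The inertial term adds only a summable error.
  Hence \<open>norm (x k - p)\<close> converges for every solution \<open>p\<close>, and \<open>x k - z k \<longlonglongrightarrow> 0\<close>
  (lemma \<open>perturbed_fejer\<close>). So \<open>norm (z k - p)\<close> converges as well, and the \<open>z k\<close> are
  approximate solutions lying in \<open>C\<close>.

  In the passage to a weak limit, the role of a weak cluster point is played by a tail point:
  a point of every closed convex set that eventually contains the sequence, along a given
  infinite set of indices. Bounded sequences have tail points because nested closed convex sets
  at bounded distance from a point have a common point (lemma \<open>nested_convex_nearest\<close>).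
  Closed half-spaces are closed convex sets, so all inequalities between continuous linear
  functionals pass to tail points. In particular a tail point of the \<open>z k\<close> lies in \<open>C\<close> and
  satisfies Minty's form of the variational inequality, so it is a solution. As in Opial's
  lemma, convergence of the distances to all solutions leaves room for only one tail point
  (lemma \<open>opial_tail_points\<close>). This gives the weak convergence of \<open>z\<close>, and hence of \<open>x\<close>.
\<close>

section \<open>Nearest points and projections in Hilbert spaces\<close>

text \<open>
  Almost nearest points \<open>u n\<close> of the sets form a Cauchy sequence by the parallelogram law: the
  midpoint of two of them stays in the earlier set, hence cannot be much closer to \<open>a\<close> than
  they are. A constant sequence of sets gives the existence of projections, and the sets
  spanned by the tails of a sequence give tail points.
\<close>

lemma nested_convex_nearest:
  fixes K :: "nat \<Rightarrow> 'a::{real_inner, complete_space} set"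
  assumes ne: "\<And>n. K n \<noteq> {}" and cl: "\<And>n. closed (K n)" and cv: "\<And>n. convex (K n)"
    and dec: "decseq K" and lim: "(\<lambda>n. infdist a (K n)) \<longlonglongrightarrow> r"
  obtains q where "\<And>n. q \<in> K n" and "dist a q \<le> r"
proof -
  have mono: "K m \<subseteq> K n" if "n \<le> m" for m n
    using dec that by (auto simp: decseq_def)
  have inf_le: "infdist a (K n) \<le> r" for n
    by (rule incseq_le[OF _ lim]) (auto simp: incseq_def intro!: infdist_mono mono ne)
  have "\<exists>u\<in>K n. dist a u \<le> r + inverse (real (Suc n))" for n
  proof -
    have "infdist a (K n) < r + inverse (real (Suc n))"
      using inf_le[of n] by (rule le_less_trans) simp
    then have "(INF u\<in>K n. dist a u) < r + inverse (real (Suc n))"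
      by (simp only: infdist_notempty[OF ne])
    then obtain u where "u \<in> K n" "dist a u < r + inverse (real (Suc n))"
      using cINF_less_iff[OF ne bdd_belowI2[of _ 0 "dist a"]] by auto
    then show ?thesis
      by (intro bexI[of _ u]) auto
  qed
  then obtain u where uK: "\<And>n. u n \<in> K n"
    and ud: "\<And>n. dist a (u n) \<le> r + inverse (real (Suc n))"
    by metis
  define t where "t n = r + inverse (real (Suc n))" for n
  have t_lim: "t \<longlonglongrightarrow> r"
    unfolding t_def using tendsto_add[OF tendsto_const LIMSEQ_inverse_real_of_nat, of r] by simp
  have para: "(dist (u i) (u j))\<^sup>2 \<le> 4 * ((t n)\<^sup>2 - (infdist a (K n))\<^sup>2)" if "n \<le> i" "n \<le> j" for n i j
  proof -
    have in_n: "u i \<in> K n" "u j \<in> K n"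
      using uK mono that by blast+
    have "(1/2) *\<^sub>R u i + (1/2) *\<^sub>R u j \<in> K n"
      using convexD[OF cv in_n, of "1/2" "1/2"] by simp
    then have "infdist a (K n) \<le> norm (a - ((1/2) *\<^sub>R u i + (1/2) *\<^sub>R u j))"
      using infdist_le[of _ "K n" a] by (simp add: dist_norm)
    then have mid: "(infdist a (K n))\<^sup>2 \<le> (norm (a - ((1/2) *\<^sub>R u i + (1/2) *\<^sub>R u j)))\<^sup>2"
      by (intro power_mono infdist_nonneg)
    have t_dist: "(norm (a - u l))\<^sup>2 \<le> (t n)\<^sup>2" if "n \<le> l" for l
    proof -
      have "inverse (real (Suc l)) \<le> inverse (real (Suc n))"
        using that by (intro le_imp_inverse_le) auto
      then have "norm (a - u l) \<le> t n"
        using ud[of l] unfolding t_def dist_norm by linarith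
      then show ?thesis
        by (intro power_mono) auto
    qed
    have "(norm (u i - u j))\<^sup>2 = 2 * (norm (a - u i))\<^sup>2 + 2 * (norm (a - u j))\<^sup>2
        - 4 * (norm (a - ((1/2) *\<^sub>R u i + (1/2) *\<^sub>R u j)))\<^sup>2"
      by (simp add: power2_norm_eq_inner inner_diff inner_add inner_commute algebra_simps)
    then show ?thesis
      using mid t_dist[OF that(1)] t_dist[OF that(2)] by (simp add: dist_norm)
  qed
  have "(\<lambda>n. 4 * ((t n)\<^sup>2 - (infdist a (K n))\<^sup>2)) \<longlonglongrightarrow> 4 * (r\<^sup>2 - r\<^sup>2)"
    by (intro tendsto_intros t_lim lim)
  then have small: "(\<lambda>n. 4 * ((t n)\<^sup>2 - (infdist a (K n))\<^sup>2)) \<longlonglongrightarrow> 0"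
    by simp
  have "Cauchy u"
  proof (rule metric_CauchyI)
    fix e :: real assume "0 < e"
    then have "\<forall>\<^sub>F n in sequentially. 4 * ((t n)\<^sup>2 - (infdist a (K n))\<^sup>2) < e\<^sup>2"
      using small by (intro order_tendstoD) auto
    then obtain n where n: "4 * ((t n)\<^sup>2 - (infdist a (K n))\<^sup>2) < e\<^sup>2"
      by (auto dest: eventually_happens)
    have "dist (u i) (u j) < e" if "i \<ge> n" "j \<ge> n" for i j
    proof (rule power2_less_imp_less)
      show "(dist (u i) (u j))\<^sup>2 < e\<^sup>2"
        using para[OF that] n by (rule le_less_trans)
    qed (use \<open>0 < e\<close> in simp)
    then show "\<exists>M. \<forall>i\<ge>M. \<forall>j\<ge>M. dist (u i) (u j) < e"
      by blast
  qed
  then obtain q where q: "u \<longlonglongrightarrow> q"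
    using Cauchy_convergent convergent_def by blast
  show thesis
  proof
    show "q \<in> K n" for n
    proof (rule Lim_in_closed_set[OF cl _ _ q])
      show "\<forall>\<^sub>F i in sequentially. u i \<in> K n"
        using eventually_ge_at_top[of n] by eventually_elim (use uK mono in blast)
    qed simp
    show "dist a q \<le> r"
    proof (rule LIMSEQ_le[OF tendsto_dist[OF tendsto_const q] t_lim])
      show "\<exists>N. \<forall>n\<ge>N. dist a (u n) \<le> t n"
        using ud by (auto simp: t_def)
    qed
  qed
qed

lemma metric_projection_nearest:
  fixes C :: "'a::{real_inner, complete_space} set"
  assumes "C \<noteq> {}" "closed C" "convex C"
  shows "metric_projection C a \<in> C \<and> (\<forall>y\<in>C. dist a (metric_projection C a) \<le> dist a y)"
proof -
  obtain q where "q \<in> C" "dist a q \<le> infdist a C"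
    using nested_convex_nearest[of "\<lambda>_. C" a "infdist a C"] assms by (auto simp: decseq_def)
  then have "q \<in> C \<and> (\<forall>y\<in>C. dist a q \<le> dist a y)"
    by (auto intro: order_trans infdist_le)
  then show ?thesis
    unfolding metric_projection_def by (rule someI)
qed

lemma metric_projection_obtuse:
  fixes C :: "'a::{real_inner, complete_space} set"
  assumes "closed C" "convex C" "y \<in> C"
  shows "inner (a - metric_projection C a) (y - metric_projection C a) \<le> 0"
  using metric_projection_nearest[of C a] assms by (intro any_closest_point_dot[of C]) auto

section \<open>Tail points and weak convergence\<close>

text \<open>
  A weak cluster point along \<open>I\<close> is a tail point, since closed convex sets are weakly closed. The
  index set \<open>I\<close> selects a subsequence without renumbering it.
\<close>

definition tail_point :: "nat set \<Rightarrow> (nat \<Rightarrow> 'a::real_normed_vector) \<Rightarrow> 'a \<Rightarrow> bool" where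
  "tail_point I u q \<longleftrightarrow>
     (\<forall>S. closed S \<and> convex S \<and> (\<forall>\<^sub>F k in sequentially. k \<in> I \<longrightarrow> u k \<in> S) \<longrightarrow> q \<in> S)"

text \<open>
  A common point of the closed convex hulls of the tails is a tail point. Such a point exists
  because the distances from the origin to these hulls increase and stay bounded.
\<close>

lemma bounded_imp_tail_point:
  fixes u :: "nat \<Rightarrow> 'a::{real_inner, complete_space}"
  assumes bdd: "bounded (range u)" and "infinite I"
  obtains q where "tail_point I u q"
proof -
  define K where "K n = closure (convex hull (u ` {k\<in>I. n \<le> k}))" for n
  have uK: "u k \<in> K n" if "k \<in> I" "n \<le> k" for k n
    unfolding K_def using that by (intro closure_subset[THEN subsetD] hull_inc) auto
  have ex: "\<exists>k\<in>I. n \<le> k" for n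
    using \<open>infinite I\<close> by (auto simp: infinite_nat_iff_unbounded_le)
  have ne: "K n \<noteq> {}" for n
    using ex[of n] uK by blast
  have dec: "decseq K"
    unfolding decseq_def K_def by (intro allI impI closure_mono hull_mono) auto
  obtain B where B: "\<And>k. norm (u k) \<le> B"
    using bdd by (auto simp: bounded_iff)
  have "infdist 0 (K n) \<le> B" for n
    using ex[of n] uK B by (metis dist_0_norm infdist_le2)
  moreover have "incseq (\<lambda>n. infdist 0 (K n))"
    using dec ne by (auto simp: incseq_def decseq_def intro!: infdist_mono)
  ultimately obtain r where "(\<lambda>n. infdist 0 (K n)) \<longlonglongrightarrow> r"
    using incseq_convergent[of "\<lambda>n. infdist 0 (K n)" B] by blast
  moreover have "closed (K n)" "convex (K n)" for n
    by (simp_all add: K_def convex_closure)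
  ultimately obtain q where q: "\<And>n. q \<in> K n"
    using nested_convex_nearest[of K 0 r] ne dec by metis
  have "q \<in> S" if S: "closed S" "convex S" "\<forall>\<^sub>F k in sequentially. k \<in> I \<longrightarrow> u k \<in> S" for S
  proof -
    obtain n where "\<And>k. n \<le> k \<Longrightarrow> k \<in> I \<Longrightarrow> u k \<in> S"
      using S(3) by (auto simp: eventually_sequentially)
    then have "K n \<subseteq> S"
      unfolding K_def using S by (intro closure_minimal hull_minimal) auto
    then show ?thesis
      using q by blast
  qed
  then show thesis
    using that[of q] by (auto simp: tail_point_def)
qed

text \<open>Apply the definition to the closed half-spaces \<open>f v \<le> c + e\<close> with \<open>e > 0\<close>.\<close>

lemma tail_point_le:
  fixes u :: "nat \<Rightarrow> 'a::real_normed_vector" and f :: "'a \<Rightarrow> real"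
  assumes q: "tail_point I u q" and f: "bounded_linear f"
    and le: "\<And>k. k \<in> I \<Longrightarrow> f (u k) \<le> b k" and b: "b \<longlonglongrightarrow> c"
  shows "f q \<le> c"
proof (rule field_le_epsilon)
  fix e :: real assume "0 < e"
  have "\<forall>\<^sub>F k in sequentially. b k < c + e"
    using b \<open>0 < e\<close> by (intro order_tendstoD) auto
  then have "\<forall>\<^sub>F k in sequentially. k \<in> I \<longrightarrow> u k \<in> {v. f v \<le> c + e}"
    by eventually_elim (use le in fastforce)
  moreover have "closed {v. f v \<le> c + e}"
    using f by (intro closed_Collect_le continuous_intros linear_continuous_on)
  moreover have "convex {v. f v \<le> c + e}"
  proof -
    have "{v. f v \<le> c + e} = f -` {..c + e}"
      by auto
    then show ?thesis
      using convex_linear_vimage[OF bounded_linear.linear[OF f]] by simp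
  qed
  ultimately show "f q \<le> c + e"
    using q by (auto simp: tail_point_def)
qed

lemma tail_point_tendsto:
  fixes u :: "nat \<Rightarrow> 'a::real_normed_vector" and f :: "'a \<Rightarrow> real"
  assumes q: "tail_point I u q" and f: "bounded_linear f" and lim: "(\<lambda>k. f (u k)) \<longlonglongrightarrow> c"
  shows "f q = c"
proof (rule antisym)
  show "f q \<le> c"
    using tail_point_le[OF q f _ lim] by simp
  have "- f q \<le> - c"
    using tail_point_le[OF q bounded_linear_minus[OF f] _ tendsto_minus[OF lim]] by simp
  then show "c \<le> f q"
    by simp
qed

text \<open>
  If \<open>norm (u k - p)\<close> and \<open>norm (u k - q)\<close> converge, then so does \<open>u k \<bullet> (p - q)\<close>, a combination
  of their squares. Hence the functional \<open>\<lambda>v. v \<bullet> (p - q)\<close> takes the same value at all tail points,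
  so two tail points \<open>p\<close> and \<open>q\<close> in \<open>S\<close> coincide. If some continuous functional \<open>f\<close>
  stayed above \<open>f p + e\<close> along infinitely many indices, then these indices would have a
  tail point different from \<open>p\<close>.
\<close>

lemma opial_tail_points:
  fixes u :: "nat \<Rightarrow> 'a::{real_inner, complete_space}"
  assumes "S \<noteq> {}"
    and conv: "\<And>p. p \<in> S \<Longrightarrow> convergent (\<lambda>k. norm (u k - p))"
    and tail: "\<And>I q. tail_point I u q \<Longrightarrow> q \<in> S"
  shows "\<exists>p\<in>S. converges_weakly u p"
proof -
  obtain s where "s \<in> S"
    using \<open>S \<noteq> {}\<close> by blast
  obtain B where "\<forall>k. norm (norm (u k - s)) \<le> B"
    using convergent_imp_Bseq[OF conv[OF \<open>s \<in> S\<close>]] unfolding Bseq_def by blast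
  then have bdd: "bounded (range u)"
    unfolding bounded_def by (intro exI[of _ s] exI[of _ B]) (auto simp: dist_norm norm_minus_commute)
  obtain p where p: "tail_point UNIV u p"
    using bounded_imp_tail_point[OF bdd, of UNIV] by auto
  have unique: "q = p" if q: "tail_point I u q" for I q
  proof -
    obtain a b where "(\<lambda>k. norm (u k - p)) \<longlonglongrightarrow> a" "(\<lambda>k. norm (u k - q)) \<longlonglongrightarrow> b"
      using conv[OF tail[OF p]] conv[OF tail[OF q]] by (auto simp: convergent_def)
    then have "(\<lambda>k. ((norm (u k - q))\<^sup>2 - (norm (u k - p))\<^sup>2 + (norm p)\<^sup>2 - (norm q)\<^sup>2) / 2)
        \<longlonglongrightarrow> (b\<^sup>2 - a\<^sup>2 + (norm p)\<^sup>2 - (norm q)\<^sup>2) / 2"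
      by (intro tendsto_intros) auto
    moreover have "((norm (u k - q))\<^sup>2 - (norm (u k - p))\<^sup>2 + (norm p)\<^sup>2 - (norm q)\<^sup>2) / 2
        = inner (u k) (p - q)" for k
      by (simp add: power2_norm_eq_inner inner_diff inner_commute field_simps)
    ultimately have lim: "(\<lambda>k. inner (u k) (p - q)) \<longlonglongrightarrow> (b\<^sup>2 - a\<^sup>2 + (norm p)\<^sup>2 - (norm q)\<^sup>2) / 2"
      by simp
    have "inner p (p - q) = inner q (p - q)"
      using tail_point_tendsto[OF p bounded_linear_inner_left lim]
        tail_point_tendsto[OF q bounded_linear_inner_left lim] by simp
    then have "inner (p - q) (p - q) = 0"
      by (simp add: inner_diff_left)
    then show ?thesis
      by simp
  qed
  have below: "\<forall>\<^sub>F k in sequentially. f (u k) < f p + e"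
    if f: "bounded_linear f" and "0 < e" for f :: "'a \<Rightarrow> real" and e
  proof (rule ccontr)
    assume "\<not> ?thesis"
    then have "infinite {k. f p + e \<le> f (u k)}"
      by (simp add: frequently_cofinite[symmetric] cofinite_eq_sequentially not_eventually not_less)
    then obtain q where q: "tail_point {k. f p + e \<le> f (u k)} u q"
      using bounded_imp_tail_point[OF bdd] by blast
    have "- f q \<le> - (f p + e)"
      by (rule tail_point_le[OF q bounded_linear_minus[OF f] _ tendsto_const]) auto
    then show False
      using unique[OF q] \<open>0 < e\<close> by simp
  qed
  have "(\<lambda>k. f (u k)) \<longlonglongrightarrow> f p" if f: "bounded_linear f" for f :: "'a \<Rightarrow> real"
  proof (rule tendstoI)
    fix e :: real assume "0 < e"
    from below[OF f this] below[OF bounded_linear_minus[OF f] this]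
    show "\<forall>\<^sub>F k in sequentially. dist (f (u k)) (f p) < e"
      by eventually_elim (auto simp: dist_real_def)
  qed
  then show ?thesis
    using tail[OF p] by (auto simp: converges_weakly_def)
qed

lemma converges_weakly_shift:
  assumes z: "converges_weakly z p" and diff: "(\<lambda>k. x k - z k) \<longlonglongrightarrow> 0"
  shows "converges_weakly x p"
  unfolding converges_weakly_def
proof (intro allI impI)
  fix f :: "'a \<Rightarrow> real" assume f: "bounded_linear f"
  have "(\<lambda>k. f (z k) + f (x k - z k)) \<longlonglongrightarrow> f p + f 0"
    using z f bounded_linear.tendsto[OF f diff]
    by (intro tendsto_add) (auto simp: converges_weakly_def)
  then show "(\<lambda>k. f (x k)) \<longlonglongrightarrow> f p"
    using linear_diff[OF bounded_linear.linear[OF f]] linear_0[OF bounded_linear.linear[OF f]] by simp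
qed

section \<open>Decrease of the distance to a solution\<close>

text \<open>Up to the accumulated errors, the sequence is decreasing and bounded below.\<close>

lemma convergent_of_summable_increase:
  fixes a e :: "nat \<Rightarrow> real"
  assumes nonneg: "\<And>k. 0 \<le> a k" and e: "summable e" and step: "\<And>k. a (Suc k) \<le> a k + e k"
  shows "convergent a"
proof -
  define b where "b k = a k - sum e {..<k}" for k
  have e_lim: "(\<lambda>k. sum e {..<k}) \<longlonglongrightarrow> suminf e"
    using e by (rule summable_LIMSEQ)
  then have "Bseq (\<lambda>k. sum e {..<k})"
    by (intro convergent_imp_Bseq convergentI)
  then obtain M where M: "\<forall>k. norm (sum e {..<k}) \<le> M"
    unfolding Bseq_def by blast
  have "decseq b"
    unfolding decseq_Suc_iff b_def using step by (simp add: algebra_simps)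
  moreover have "- M \<le> b k" for k
    using nonneg[of k] M[rule_format, of k] by (simp add: b_def)
  ultimately obtain l where "b \<longlonglongrightarrow> l"
    using decseq_convergent by blast
  then have "(\<lambda>k. b k + sum e {..<k}) \<longlonglongrightarrow> l + suminf e"
    using e_lim by (intro tendsto_add)
  then show ?thesis
    by (auto simp: b_def convergent_def)
qed

text \<open>
  Here \<open>a k\<close> is the distance to a solution before a step, \<open>w k\<close> the distance before the error is
  added, and \<open>\<delta> k\<close> the residual whose square is gained. Since \<open>w k\<close> is squeezed between
  \<open>a (Suc k) - e k\<close> and \<open>a k\<close>, the gain \<open>(a k)\<^sup>2 - (w k)\<^sup>2\<close> vanishes in the limit.
\<close>

lemma perturbed_fejer:
  fixes a w e \<delta> :: "nat \<Rightarrow> real"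
  assumes nonneg: "\<And>k. 0 \<le> a k" "\<And>k. 0 \<le> w k" and e: "summable e" and "0 < c"
    and gain: "\<And>k. (w k)\<^sup>2 \<le> (a k)\<^sup>2 - c * (\<delta> k)\<^sup>2"
    and step: "\<And>k. a (Suc k) \<le> w k + e k"
  shows "convergent a" and "\<delta> \<longlonglongrightarrow> 0"
proof -
  have wa: "w k \<le> a k" for k
  proof (rule power2_le_imp_le)
    have "0 \<le> c * (\<delta> k)\<^sup>2"
      using \<open>0 < c\<close> by simp
    then show "(w k)\<^sup>2 \<le> (a k)\<^sup>2"
      using gain[of k] by simp
  qed (rule nonneg)
  show conv: "convergent a"
    using wa by (intro convergent_of_summable_increase[OF nonneg(1) e] order_trans[OF step]) simp
  then obtain l where a: "a \<longlonglongrightarrow> l"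
    by (auto simp: convergent_def)
  have lower: "(\<lambda>k. a (Suc k) - e k) \<longlonglongrightarrow> l - 0"
    using LIMSEQ_Suc[OF a] summable_LIMSEQ_zero[OF e] by (rule tendsto_diff)
  have w: "w \<longlonglongrightarrow> l"
  proof (rule tendsto_sandwich[OF _ _ _ a])
    show "(\<lambda>k. a (Suc k) - e k) \<longlonglongrightarrow> l"
      using lower by simp
    show "\<forall>\<^sub>F k in sequentially. a (Suc k) - e k \<le> w k"
      using step by (simp add: diff_le_eq)
    show "\<forall>\<^sub>F k in sequentially. w k \<le> a k"
      using wa by simp
  qed
  have "(\<lambda>k. ((a k)\<^sup>2 - (w k)\<^sup>2) / c) \<longlonglongrightarrow> (l\<^sup>2 - l\<^sup>2) / c"
    using \<open>0 < c\<close> by (intro tendsto_intros a w) simp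
  then have "(\<lambda>k. ((a k)\<^sup>2 - (w k)\<^sup>2) / c) \<longlonglongrightarrow> 0"
    by simp
  then have "(\<lambda>k. (\<delta> k)\<^sup>2) \<longlonglongrightarrow> 0"
  proof (rule tendsto_sandwich[OF _ _ tendsto_const, rotated 2])
    show "\<forall>\<^sub>F k in sequentially. (\<delta> k)\<^sup>2 \<le> ((a k)\<^sup>2 - (w k)\<^sup>2) / c"
      using gain \<open>0 < c\<close> by (auto simp: pos_le_divide_eq mult.commute algebra_simps)
  qed simp
  then show "\<delta> \<longlonglongrightarrow> 0"
    by simp
qed

text \<open>
  Add the obtuse-angle inequality at the projection \<open>z\<close>, tested with the solution \<open>p\<close>, and
  \<open>b * (F z \<bullet> (z - p)) \<ge> 0\<close>, which holds by monotonicity because \<open>p\<close> is a solution.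
\<close>

lemma solution_behind_hyperplane:
  fixes C :: "'a::{real_inner, complete_space} set"
  assumes C: "closed C" "convex C" and F: "monotone_operator F" and p: "p \<in> SOL C F" and "0 < b"
    and z: "z = metric_projection C (x - b *\<^sub>R F x)"
  shows "0 \<le> inner (z - p) (pc_direction F b x z)"
proof -
  have "p \<in> C"
    using p by (simp add: SOL_def)
  have "z \<in> C"
    using metric_projection_nearest[of C] C \<open>p \<in> C\<close> z by blast
  have "inner (x - b *\<^sub>R F x - z) (p - z) \<le> 0"
    using metric_projection_obtuse[OF C \<open>p \<in> C\<close>] z by simp
  moreover have "0 \<le> inner (F z) (z - p)"
  proof -
    have "0 \<le> inner (F p) (z - p)"
      using p \<open>z \<in> C\<close> by (simp add: SOL_def)
    moreover have "0 \<le> inner (F z - F p) (z - p)"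
      using F by (simp add: monotone_operator_def)
    ultimately show ?thesis
      by (simp add: inner_diff_left)
  qed
  then have "0 \<le> b * inner (F z) (z - p)"
    using \<open>0 < b\<close> by simp
  ultimately show ?thesis
    by (simp add: pc_direction_def inner_diff inner_add inner_commute algebra_simps)
qed

text \<open>
  With \<open>t = (x - z) \<bullet> d\<close>, the relaxed projection gains at least \<open>\<gamma> * (2 - \<gamma>) * (t / norm d)\<^sup>2\<close>.
  The step size condition makes \<open>d\<close> a perturbation of \<open>x - z\<close> of relative size \<open>\<nu>\<close>,
  so \<open>t \<ge> (1 - \<nu>) * (norm (x - z))\<^sup>2\<close> and \<open>norm d \<le> (1 + \<nu>) * norm (x - z)\<close>.
\<close>

lemma contraction_step_decrease:
  fixes x z p :: "'a::real_inner" and F :: "'a \<Rightarrow> 'a" and b :: real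
  defines "d \<equiv> pc_direction F b x z"
  assumes "0 < b" and "0 < \<nu>" "\<nu> < 1" and "0 < \<gamma>" "\<gamma> < 2" and "d \<noteq> 0"
    and step: "b * norm (F x - F z) \<le> \<nu> * norm (x - z)"
    and behind: "0 \<le> inner (z - p) d"
  shows "(norm (x - (\<gamma> * pc_rho F b x z) *\<^sub>R d - p))\<^sup>2
      \<le> (norm (x - p))\<^sup>2 - \<gamma> * (2 - \<gamma>) * ((1 - \<nu>) / (1 + \<nu>))\<^sup>2 * (norm (x - z))\<^sup>2"
proof -
  define t where "t = inner (x - z) d"
  have rho: "pc_rho F b x z = t / (norm d)\<^sup>2"
    by (simp add: pc_rho_def t_def d_def)
  have "0 < norm d"
    using \<open>d \<noteq> 0\<close> by simp
  have pert: "norm (b *\<^sub>R (F x - F z)) \<le> \<nu> * norm (x - z)"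
    using step \<open>0 < b\<close> by simp
  have d_eq: "d = (x - z) - b *\<^sub>R (F x - F z)"
    by (simp add: d_def pc_direction_def)
  have d_le: "norm d \<le> (1 + \<nu>) * norm (x - z)"
    using norm_triangle_ineq4[of "x - z" "b *\<^sub>R (F x - F z)"] pert
    unfolding d_eq by (simp add: algebra_simps)
  have "inner (x - z) (b *\<^sub>R (F x - F z)) \<le> norm (x - z) * (\<nu> * norm (x - z))"
    by (rule order_trans[OF norm_cauchy_schwarz mult_left_mono[OF pert]]) simp
  then have t_ge: "(1 - \<nu>) * (norm (x - z))\<^sup>2 \<le> t"
    unfolding t_def d_eq inner_diff_right[of "x - z" "x - z"] power2_norm_eq_inner[symmetric]
    by (simp add: power2_eq_square algebra_simps)
  have "(1 - \<nu>) / (1 + \<nu>) * norm (x - z) \<le> t / norm d"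
  proof -
    have "(1 - \<nu>) / (1 + \<nu>) * norm (x - z) * norm d
        \<le> (1 - \<nu>) / (1 + \<nu>) * norm (x - z) * ((1 + \<nu>) * norm (x - z))"
      using \<open>0 < \<nu>\<close> \<open>\<nu> < 1\<close> by (intro mult_left_mono d_le) auto
    also have "\<dots> = (1 - \<nu>) * (norm (x - z))\<^sup>2"
      using \<open>0 < \<nu>\<close> by (simp add: power2_eq_square field_simps)
    finally show ?thesis
      using t_ge \<open>0 < norm d\<close> by (simp add: pos_le_divide_eq)
  qed
  then have "((1 - \<nu>) / (1 + \<nu>) * norm (x - z))\<^sup>2 \<le> (t / norm d)\<^sup>2"
    using \<open>0 < \<nu>\<close> \<open>\<nu> < 1\<close> by (intro power_mono) auto
  then have gain: "\<gamma> * (2 - \<gamma>) * ((1 - \<nu>) / (1 + \<nu>) * norm (x - z))\<^sup>2 \<le> \<gamma> * (2 - \<gamma>) * (t / norm d)\<^sup>2"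
    using \<open>0 < \<gamma>\<close> \<open>\<gamma> < 2\<close> by (intro mult_left_mono) auto
  have "0 \<le> t"
    using t_ge \<open>\<nu> < 1\<close> by (smt (verit) mult_nonneg_nonneg zero_le_power2)
  define s where "s = \<gamma> * (t / (norm d)\<^sup>2)"
  have "0 \<le> s"
    using \<open>0 \<le> t\<close> \<open>0 < \<gamma>\<close> by (simp add: s_def)
  have "t \<le> inner (x - p) d"
    using behind by (simp add: t_def inner_diff_left)
  then have "s * t \<le> s * inner (x - p) d"
    using \<open>0 \<le> s\<close> by (rule mult_left_mono)
  moreover have "(norm (x - s *\<^sub>R d - p))\<^sup>2
      = (norm (x - p))\<^sup>2 - 2 * (s * inner (x - p) d) + s\<^sup>2 * (norm d)\<^sup>2"
    unfolding power2_norm_eq_inner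
    by (simp add: inner_diff inner_commute power2_eq_square algebra_simps)
  ultimately have "(norm (x - s *\<^sub>R d - p))\<^sup>2 \<le> (norm (x - p))\<^sup>2 - 2 * (s * t) + s\<^sup>2 * (norm d)\<^sup>2"
    by simp
  also have "\<dots> = (norm (x - p))\<^sup>2 - \<gamma> * (2 - \<gamma>) * (t / norm d)\<^sup>2"
    using \<open>0 < norm d\<close> by (simp add: s_def power2_eq_square field_simps)
  also have "\<dots> \<le> (norm (x - p))\<^sup>2 - \<gamma> * (2 - \<gamma>) * ((1 - \<nu>) / (1 + \<nu>) * norm (x - z))\<^sup>2"
    using gain by simp
  finally show ?thesis
    unfolding rho s_def power_mult_distrib by (simp add: mult.assoc)
qed

section \<open>Solutions as limits of approximate solutions\<close>

text \<open>
  Minty's argument: test with the points \<open>q + s (y - q)\<close> of the segment from \<open>q\<close> to \<open>y\<close>, divide by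
  \<open>s > 0\<close> and let \<open>s\<close> tend to zero. Unlike the variational inequality, the hypothesis is affine
  in \<open>q\<close> for fixed \<open>y\<close>, so it survives weak limits.
\<close>

lemma minty_imp_SOL:
  fixes F :: "'a::real_inner \<Rightarrow> 'a"
  assumes "convex C" and F: "continuous_on UNIV F" and "q \<in> C"
    and minty: "\<And>y. y \<in> C \<Longrightarrow> 0 \<le> inner (F y) (y - q)"
  shows "q \<in> SOL C F"
proof -
  have "0 \<le> inner (F q) (y - q)" if "y \<in> C" for y
  proof -
    define s where "s n = inverse (real (Suc n))" for n
    have s: "0 < s n" "s n \<le> 1" for n
      by (auto simp: s_def field_simps)
    have "0 \<le> inner (F (q + s n *\<^sub>R (y - q))) (y - q)" for n
    proof -
      have "(1 - s n) *\<^sub>R q + s n *\<^sub>R y \<in> C"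
        using \<open>q \<in> C\<close> \<open>y \<in> C\<close> s[of n] by (intro convexD[OF \<open>convex C\<close>]) auto
      then have "q + s n *\<^sub>R (y - q) \<in> C"
        by (simp add: algebra_simps)
      from minty[OF this] s[of n] show ?thesis
        by (simp add: zero_le_mult_iff)
    qed
    moreover have "(\<lambda>n. inner (F (q + s n *\<^sub>R (y - q))) (y - q)) \<longlonglongrightarrow> inner (F q) (y - q)"
    proof -
      have "(\<lambda>n. q + s n *\<^sub>R (y - q)) \<longlonglongrightarrow> q + 0 *\<^sub>R (y - q)"
        unfolding s_def by (intro tendsto_intros LIMSEQ_inverse_real_of_nat)
      then have "(\<lambda>n. F (q + s n *\<^sub>R (y - q))) \<longlonglongrightarrow> F q"
        using F by (intro continuous_on_tendsto_compose[OF F]) auto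
      then show ?thesis
        by (intro tendsto_intros)
    qed
    ultimately show ?thesis
      by (intro LIMSEQ_le_const) auto
  qed
  then show ?thesis
    using \<open>q \<in> C\<close> by (simp add: SOL_def)
qed

text \<open>
  The projection inequality bounds \<open>F x \<bullet> (y - z)\<close> below by \<open>(x - z) \<bullet> (y - z) / \<beta>\<close>, and
  the lower bound on \<open>\<beta>\<close> controls this by the residual \<open>norm (x - z)\<close>. Replacing \<open>F x\<close> by
  \<open>F z\<close> costs another multiple of the residual by Lipschitz continuity, and replacing \<open>F z\<close> by
  \<open>F y\<close> is free by monotonicity. The left-hand side that remains is affine in \<open>z\<close>, so it passes to
  tail points.
\<close>

lemma approximate_minty:
  fixes C :: "'a::{real_inner, complete_space} set"
  assumes C: "closed C" "convex C" and F: "monotone_operator F" "L-lipschitz_on UNIV F"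
    and "0 < b" "b \<le> \<beta>" and z: "z = metric_projection C (x - \<beta> *\<^sub>R F x)" and "y \<in> C"
  shows "inner (F y) (z - y) \<le> (L + 1 / b) * (norm (x - z) * norm (y - z))"
proof -
  have "0 < \<beta>"
    using \<open>0 < b\<close> \<open>b \<le> \<beta>\<close> by simp
  have "inner (x - \<beta> *\<^sub>R F x - z) (y - z) \<le> 0"
    using metric_projection_obtuse[OF C \<open>y \<in> C\<close>] z by simp
  then have "- \<beta> * inner (F x) (y - z) \<le> - inner (x - z) (y - z)"
    by (simp add: inner_diff_left)
  also have "\<dots> \<le> norm (x - z) * norm (y - z)"
    using Cauchy_Schwarz_ineq2[of "x - z" "y - z"] by simp
  finally have "- inner (F x) (y - z) \<le> (norm (x - z) * norm (y - z)) / \<beta>"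
    using \<open>0 < \<beta>\<close> by (simp add: pos_le_divide_eq mult.commute)
  also have "\<dots> \<le> (norm (x - z) * norm (y - z)) / b"
    using \<open>0 < b\<close> \<open>b \<le> \<beta>\<close> by (intro divide_left_mono) auto
  finally have proj: "- inner (F x) (y - z) \<le> (norm (x - z) * norm (y - z)) / b" .
  have "inner (F x - F z) (y - z) \<le> norm (F x - F z) * norm (y - z)"
    by (rule norm_cauchy_schwarz)
  also have "\<dots> \<le> L * norm (x - z) * norm (y - z)"
    using lipschitz_onD[OF F(2), of x z] by (intro mult_right_mono) (auto simp: dist_norm)
  finally have lip: "inner (F x - F z) (y - z) \<le> L * norm (x - z) * norm (y - z)" .
  have "0 \<le> inner (F y - F z) (y - z)"
    using F(1) by (simp add: monotone_operator_def)
  with proj lip show ?thesis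
    by (simp add: inner_diff_left inner_diff_right algebra_simps)
qed

section \<open>Weak convergence of the inertial projection and contraction method\<close>

theorem theorem5p2:
  fixes C :: "'a::{real_inner, complete_space} set"
    and F :: "'a \<Rightarrow> 'a"
    and L \<nu> \<gamma> :: real
    and \<alpha>1 \<alpha>2 \<beta> :: "nat \<Rightarrow> real"
    and xm :: 'a
    and x y z :: "nat \<Rightarrow> 'a"
  assumes "C \<noteq> {}" and "closed C" and "convex C"
    and "SOL C F \<noteq> {}"
    and "monotone_operator F"
    and "0 < L" and "L-lipschitz_on UNIV F"
    and "0 < \<nu>" and "\<nu> < 1"
    and "0 < \<gamma>" and "\<gamma> < 2"
    and "\<forall>k. 0 \<le> \<alpha>1 k \<and> \<alpha>1 k \<le> 1"
    and "\<forall>k. 0 \<le> \<alpha>2 k \<and> \<alpha>2 k \<le> 1"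
    and beta_bounded_away_from_0: "\<exists>b>0. \<forall>k. b \<le> \<beta> k"
    and "iPC_I1 C F \<nu> \<gamma> \<alpha>1 \<alpha>2 \<beta> xm x y z"
    and "summable (\<lambda>k. \<alpha>1 k * norm (x k - previous xm x k))"
    and "summable (\<lambda>k. \<alpha>2 k * norm (x k - previous xm x k))"
  shows "\<exists>p\<in>SOL C F. converges_weakly x p"
proof -
  obtain b where "0 < b" and b: "\<And>k. b \<le> \<beta> k"
    using beta_bounded_away_from_0 by blast
  define d where "d k = pc_direction F (\<beta> k) (x k) (z k)" for k
  define w where "w k = x k - (\<gamma> * pc_rho F (\<beta> k) (x k) (z k)) *\<^sub>R d k" for k
  define e where "e k = \<alpha>2 k * norm (x k - previous xm x k)" for k
  have z: "z k = metric_projection C (x k - \<beta> k *\<^sub>R F (x k))" for k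
    using \<open>iPC_I1 C F \<nu> \<gamma> \<alpha>1 \<alpha>2 \<beta> xm x y z\<close> by (simp add: iPC_I1_def)
  have beta: "0 < \<beta> k" "\<beta> k * norm (F (x k) - F (z k)) \<le> \<nu> * norm (x k - z k)"
    and d0: "d k \<noteq> 0"
    and x_Suc: "x (Suc k) = w k + \<alpha>2 k *\<^sub>R (x k - previous xm x k)" for k
    using \<open>iPC_I1 C F \<nu> \<gamma> \<alpha>1 \<alpha>2 \<beta> xm x y z\<close> unfolding iPC_I1_def d_def w_def by blast+
  have "z k \<in> C" for k
    using metric_projection_nearest[OF \<open>C \<noteq> {}\<close> \<open>closed C\<close> \<open>convex C\<close>] z by simp
  define c where "c = \<gamma> * (2 - \<gamma>) * ((1 - \<nu>) / (1 + \<nu>))\<^sup>2"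
  have "0 < c"
    using \<open>0 < \<nu>\<close> \<open>\<nu> < 1\<close> \<open>0 < \<gamma>\<close> \<open>\<gamma> < 2\<close> by (simp add: c_def)
  have gain: "(norm (w k - p))\<^sup>2 \<le> (norm (x k - p))\<^sup>2 - c * (norm (x k - z k))\<^sup>2"
    if "p \<in> SOL C F" for p k
    unfolding w_def d_def c_def
  proof (rule contraction_step_decrease)
    show "0 \<le> inner (z k - p) (pc_direction F (\<beta> k) (x k) (z k))"
      using solution_behind_hyperplane[OF \<open>closed C\<close> \<open>convex C\<close> \<open>monotone_operator F\<close> that beta(1) z] .
  qed (use beta d0 \<open>0 < \<nu>\<close> \<open>\<nu> < 1\<close> \<open>0 < \<gamma>\<close> \<open>\<gamma> < 2\<close> in \<open>auto simp: d_def\<close>)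
  have step: "norm (x (Suc k) - p) \<le> norm (w k - p) + e k" for p k
  proof -
    have "norm (x (Suc k) - p) = norm ((w k - p) + \<alpha>2 k *\<^sub>R (x k - previous xm x k))"
      by (simp add: x_Suc algebra_simps)
    also have "\<dots> \<le> norm (w k - p) + e k"
      using norm_triangle_ineq[of "w k - p" "\<alpha>2 k *\<^sub>R (x k - previous xm x k)"]
        \<open>\<forall>k. 0 \<le> \<alpha>2 k \<and> \<alpha>2 k \<le> 1\<close> by (simp add: e_def)
    finally show ?thesis .
  qed
  have "summable e"
    unfolding e_def by fact
  \<comment> \<open>\<open>x (Suc k)\<close> differs from \<open>w k\<close> only by the inertial term, whose norm is the summable \<open>e k\<close>.\<close>
  note fejer = perturbed_fejer[OF norm_ge_zero norm_ge_zero \<open>summable e\<close> \<open>0 < c\<close> gain step]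
  obtain p0 where "p0 \<in> SOL C F"
    using \<open>SOL C F \<noteq> {}\<close> by blast
  have residual: "(\<lambda>k. norm (x k - z k)) \<longlonglongrightarrow> 0"
    using fejer(2)[OF \<open>p0 \<in> SOL C F\<close>] .
  then have diff: "(\<lambda>k. x k - z k) \<longlonglongrightarrow> 0"
    by (rule tendsto_norm_zero_cancel)
  have conv: "convergent (\<lambda>k. norm (z k - p))" if p: "p \<in> SOL C F" for p
  proof -
    obtain l where l: "(\<lambda>k. norm (x k - p)) \<longlonglongrightarrow> l"
      using fejer(1)[OF p] by (auto simp: convergent_def)
    have "(\<lambda>k. norm (z k - p) - norm (x k - p)) \<longlonglongrightarrow> 0"
    proof (rule Lim_null_comparison[OF _ residual])
      show "\<forall>\<^sub>F k in sequentially. norm (norm (z k - p) - norm (x k - p)) \<le> norm (x k - z k)"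
        using norm_triangle_ineq3[of "z _ - p" "x _ - p"] by (simp add: norm_minus_commute)
    qed
    from tendsto_add[OF this l] show ?thesis
      by (auto simp: convergent_def)
  qed
  have tail: "q \<in> SOL C F" if q: "tail_point I z q" for I q
  proof (rule minty_imp_SOL[OF \<open>convex C\<close>])
    show "continuous_on UNIV F"
      using \<open>L-lipschitz_on UNIV F\<close> by (rule lipschitz_on_continuous_on)
    show "q \<in> C"
      using q \<open>closed C\<close> \<open>convex C\<close> \<open>\<And>k. z k \<in> C\<close> by (simp add: tail_point_def)
    show "0 \<le> inner (F v) (v - q)" if "v \<in> C" for v
    proof -
      obtain M where "\<forall>k. norm (norm (z k - p0)) \<le> M"
        using convergent_imp_Bseq[OF conv[OF \<open>p0 \<in> SOL C F\<close>]] unfolding Bseq_def by blast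
      then have M: "norm (z k - p0) \<le> M" for k
        by simp
      have "inner (F v) (z k) \<le> inner (F v) v
          + (L + 1 / b) * (norm (x k - z k) * (norm (v - p0) + M))" for k
      proof -
        have "norm (v - z k) \<le> norm (v - p0) + M"
          using norm_triangle_ineq4[of "v - p0" "z k - p0"] M[of k] by simp
        then have "(L + 1 / b) * (norm (x k - z k) * norm (v - z k))
            \<le> (L + 1 / b) * (norm (x k - z k) * (norm (v - p0) + M))"
          using \<open>0 < L\<close> \<open>0 < b\<close> by (intro mult_left_mono) auto
        then show ?thesis
          using approximate_minty[OF \<open>closed C\<close> \<open>convex C\<close> \<open>monotone_operator F\<close>
              \<open>L-lipschitz_on UNIV F\<close> \<open>0 < b\<close> b z \<open>v \<in> C\<close>, of k]
          by (simp add: inner_diff_right)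
      qed
      moreover have "(\<lambda>k. inner (F v) v + (L + 1 / b) * (norm (x k - z k) * (norm (v - p0) + M)))
          \<longlonglongrightarrow> inner (F v) v + (L + 1 / b) * (0 * (norm (v - p0) + M))"
        by (intro tendsto_intros residual)
      ultimately have "inner (F v) q \<le> inner (F v) v + (L + 1 / b) * (0 * (norm (v - p0) + M))"
        by (intro tail_point_le[OF q bounded_linear_inner_right])
      then show ?thesis
        by (simp add: inner_diff_right)
    qed
  qed
  obtain p where "p \<in> SOL C F" "converges_weakly z p"
    using opial_tail_points[of "SOL C F" z] \<open>SOL C F \<noteq> {}\<close> conv tail by blast
  then show ?thesis
    using converges_weakly_shift[OF _ diff] by blast
qed

end
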